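(* For any $n\ge1$ and any pattern pair $p\in\{(012,201),(012,210)\}$, we have $$|\mathbf{I}_n(p)|=2^{n+1}-\binom{n+1}{3}-2n-1.$$
   Context: An inversion sequence of length $n$ is an integer sequence $e=(e_1,\dots,e_n)$ with $0\le e_i\le i-1$ for all $1\le i\le n$. A word $w_1\cdots w_n$ avoids a pattern $P=p_1\cdots p_k$ if there are no $i_1<\cdots<i_k$ such that $w_{i_1}\cdots w_{i_k}$ is order isomorphic to $P$ (equal letters of $P$ corresponding to equal entries). For a pair $p=(P_1,P_2)$ of patterns, $\mathbf{I}_n(p)$ denotes the set of inversion sequences of length $n$ avoiding both $P_1$ and $P_2$. *)

theory Defs
  imports Main
begin

text \<open>Lists are indexed from 0, so the bound \<open>e\<^sub>i \<le> i - 1\<close> for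
  \<open>1 \<le> i \<le> n\<close> reads \<open>e ! i \<le> i\<close> for \<open>i < n\<close>; nonnegativity is built into \<open>nat\<close>.\<close>

definition inversion_sequences :: "nat \<Rightarrow> nat list set" where
  "inversion_sequences n = {e. length e = n \<and> (\<forall>i<n. e ! i \<le> i)}"

definition order_isomorphic :: "'a::linorder list \<Rightarrow> 'b::linorder list \<Rightarrow> bool" where
  "order_isomorphic u v \<longleftrightarrow> length u = length v \<and>
     (\<forall>i<length u. \<forall>j<length u.
        (u ! i < u ! j \<longleftrightarrow> v ! i < v ! j) \<and> (u ! i = u ! j \<longleftrightarrow> v ! i = v ! j))"

text \<open>The list \<open>is\<close> collects the positions \<open>i\<^sub>1 < \<dots> < i\<^sub>k\<close> of an occurrence of the pattern.\<close>

definition contains_pattern :: "'a::linorder list \<Rightarrow> nat list \<Rightarrow> bool" where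
  "contains_pattern w P \<longleftrightarrow>
     (\<exists>is. sorted_wrt (<) is \<and> set is \<subseteq> {..<length w} \<and>
           order_isomorphic (map (\<lambda>i. w ! i) is) P)"

definition avoids_pattern :: "'a::linorder list \<Rightarrow> nat list \<Rightarrow> bool" where
  "avoids_pattern w P \<longleftrightarrow> \<not> contains_pattern w P"

definition inversion_sequences_avoiding :: "nat \<Rightarrow> nat list \<times> nat list \<Rightarrow> nat list set" where
  "inversion_sequences_avoiding n p =
     {e \<in> inversion_sequences n. avoids_pattern e (fst p) \<and> avoids_pattern e (snd p)}"

end

theory Submission
  imports Defs
begin

text \<open>
  An inversion sequence starts with \<open>0\<close>, so two increasing positive entries would complete a
  \<open>012\<close>: avoiding \<open>012\<close> means that the positive entries decrease weakly. Hence a nonzero sequence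
  consists of \<open>i\<close> zeros, a first positive entry \<open>c \<le> i\<close>, and a tail of length \<open>m = n - 1 - i\<close> with
  entries in \<open>{0..c}\<close>. For such a tail the bound \<open>e ! j \<le> j\<close> holds automatically, and leading zeros
  cannot play the largest letter of \<open>201\<close> or \<open>210\<close>. The count is therefore
  \<open>1 + (\<Sum>i<n. \<Sum>c=1..i. t(c, n - 1 - i))\<close>,
  where \<open>t(c, m)\<close> is the number of admissible tails after \<open>c\<close>, and the \<open>1\<close> is the zero sequence
  (\<open>card_good_continuations\<close>).

  In the tail it suffices to look at pairs of entries, because \<open>c\<close> itself is the best choice for the
  largest letter of the second pattern (\<open>good_tails_eq\<close>). Reading the tail by its first letter
  then determines \<open>t\<close>:

  \<^item> For \<open>201\<close>, after a \<open>0\<close> only the letters \<open>0\<close> and \<open>c\<close> may occur, and after a letter \<open>h\<close> with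
    \<open>0 < h < c\<close> the tail decreases weakly from \<open>h\<close> down to \<open>0\<close>. The tails are the words
    over \<open>{0, c}\<close> together with the weakly decreasing words over \<open>{0..c}\<close>; the words \<open>c\<dots>c0\<dots>0\<close> are
    both, so \<open>t(c, m) = 2^m + binom(c + m, m) - (m + 1)\<close>.
  \<^item> For \<open>210\<close>, the letters \<open>0\<close> and \<open>c\<close> impose nothing, whereas a letter \<open>h\<close> with \<open>0 < h < c\<close> must be
    repeated to the end, so \<open>t(c, m) = 2^m + (c - 1) (2^m - 1)\<close>.

  Summed over \<open>c\<close> and \<open>i\<close>, the words with at most one positive value contribute \<open>2^n - n\<close> in both
  cases. The remaining ones contribute \<open>2^n - 1 - n - binom(n + 1, 3)\<close>: for \<open>201\<close> as
  \<open>\<Sum>i<n. (binom(n, i) - 1 - i (n - i))\<close>, for \<open>210\<close> as \<open>\<Sum>i<n. binom(i, 2) (2^(n - 1 - i) - 1)\<close>.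
\<close>

section \<open>Patterns of length three\<close>

text \<open>Occurrences of a pattern of length three, as a ternary relation on entries: unlike occurrences
  at chosen positions, this notion unfolds along \<open>Cons\<close>.\<close>

definition triple_free :: "('a \<Rightarrow> 'a \<Rightarrow> 'a \<Rightarrow> bool) \<Rightarrow> 'a list \<Rightarrow> bool" where
  "triple_free Q w \<longleftrightarrow> (\<forall>k<length w. \<forall>j<k. \<forall>i<j. \<not> Q (w ! i) (w ! j) (w ! k))"

lemma triple_free_Nil [simp]: "triple_free Q []"
  by (simp add: triple_free_def)

lemma triple_free_Cons [simp]:
  "triple_free Q (x # w) \<longleftrightarrow> triple_free Q w \<and> sorted_wrt (\<lambda>a b. \<not> Q x a b) w"
  unfolding triple_free_def sorted_wrt_iff_nth_less
  by (simp add: All_less_Suc2) blast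

lemma avoids_pattern_iff_triple_free:
  "avoids_pattern w [p, q, r] \<longleftrightarrow> triple_free (\<lambda>x y z. order_isomorphic [x, y, z] [p, q, r]) w"
proof -
  have "contains_pattern w [p, q, r] \<longleftrightarrow>
    (\<exists>k<length w. \<exists>j<k. \<exists>i<j. order_isomorphic [w ! i, w ! j, w ! k] [p, q, r])" (is "?L \<longleftrightarrow> ?R")
  proof
    assume ?L
    then obtain "is" where s: "sorted_wrt (<) is" "set is \<subseteq> {..<length w}"
      and o: "order_isomorphic (map (\<lambda>i. w ! i) is) [p, q, r]"
      by (auto simp: contains_pattern_def)
    from o have "length is = 3" by (simp add: order_isomorphic_def)
    then obtain i j k where "is = [i, j, k]"
      by (auto simp: numeral_eq_Suc length_Suc_conv)
    with s o show ?R by auto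
  next
    assume ?R
    then obtain i j k where "k < length w" "j < k" "i < j"
      "order_isomorphic [w ! i, w ! j, w ! k] [p, q, r]" by blast
    then show ?L unfolding contains_pattern_def
      by (intro exI[of _ "[i, j, k]"]) auto
  qed
  then show ?thesis
    by (simp add: avoids_pattern_def triple_free_def)
qed

lemma avoids_012_iff:
  "avoids_pattern w [0, 1, 2] \<longleftrightarrow> triple_free (\<lambda>x y z. x < y \<and> y < z) w"
proof -
  have "order_isomorphic [x, y, z] [0, 1, 2::nat] \<longleftrightarrow> x < y \<and> y < z" for x y z :: 'a
    by (auto simp: order_isomorphic_def All_less_Suc2)
  then show ?thesis by (simp only: avoids_pattern_iff_triple_free)
qed

lemma avoids_201_iff:
  "avoids_pattern w [2, 0, 1] \<longleftrightarrow> triple_free (\<lambda>x y z. y < z \<and> z < x) w"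
proof -
  have "order_isomorphic [x, y, z] [2, 0, 1::nat] \<longleftrightarrow> y < z \<and> z < x" for x y z :: 'a
    by (auto simp: order_isomorphic_def All_less_Suc2)
  then show ?thesis by (simp only: avoids_pattern_iff_triple_free)
qed

lemma avoids_210_iff:
  "avoids_pattern w [2, 1, 0] \<longleftrightarrow> triple_free (\<lambda>x y z. z < y \<and> y < x) w"
proof -
  have "order_isomorphic [x, y, z] [2, 1, 0::nat] \<longleftrightarrow> z < y \<and> y < x" for x y z :: 'a
    by (auto simp: order_isomorphic_def All_less_Suc2)
  then show ?thesis by (simp only: avoids_pattern_iff_triple_free)
qed

section \<open>Splitting off the leading zeros\<close>

text \<open>Every enumeration below is a recursion on the first letter, and this is the step that they
  share. The common finite alphabet \<open>H\<close> keeps all the sets finite.\<close>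

lemma card_lists_by_head:
  assumes "finite H" and sub: "\<And>xs. length xs = Suc m \<Longrightarrow> P xs \<Longrightarrow> set xs \<subseteq> H"
  shows "card {xs. length xs = Suc m \<and> P xs} = (\<Sum>h\<in>H. card {ys. length ys = m \<and> P (h # ys)})"
proof -
  let ?F = "\<lambda>h. {ys. length ys = m \<and> P (h # ys)}"
  have dec: "{xs. length xs = Suc m \<and> P xs} = (\<Union>h\<in>H. Cons h ` ?F h)"
    using sub by (fastforce simp: length_Suc_conv)
  have "finite (?F h)" for h
    by (rule finite_subset[OF _ finite_lists_length_eq[OF \<open>finite H\<close>, of m]])
      (use sub[of "h # _"] in auto)
  then have "card (\<Union>h\<in>H. Cons h ` ?F h) = (\<Sum>h\<in>H. card (Cons h ` ?F h))"
    using \<open>finite H\<close> by (intro card_UN_disjoint) auto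
  also have "\<dots> = (\<Sum>h\<in>H. card (?F h))"
    by (simp add: card_image)
  finally show ?thesis by (simp only: dec)
qed

text \<open>What may follow \<open>0\<dots>0 c\<close>. One zero in front stands for all of them, because a
  leading zero can only serve as the smallest letter of \<open>012\<close>.\<close>

definition good_tails :: "(nat \<Rightarrow> nat \<Rightarrow> nat \<Rightarrow> bool) \<Rightarrow> nat \<Rightarrow> nat \<Rightarrow> nat list set" where
  "good_tails Q c m = {xs. length xs = m \<and>
     triple_free (\<lambda>x y z. x < y \<and> y < z) (0 # c # xs) \<and> triple_free Q (0 # c # xs)}"

text \<open>What may follow \<open>i\<close> zeros, so that the entry at index \<open>j\<close> of the continuation sits at index
  \<open>i + j\<close> of the inversion sequence. With \<open>i = 0\<close> the zero put in front is an artificial one.\<close>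

definition good_continuations :: "(nat \<Rightarrow> nat \<Rightarrow> nat \<Rightarrow> bool) \<Rightarrow> nat \<Rightarrow> nat \<Rightarrow> nat list set" where
  "good_continuations Q i m = {xs. length xs = m \<and> ((\<forall>j<m. xs ! j \<le> i + j) \<and>
     triple_free (\<lambda>x y z. x < y \<and> y < z) (0 # xs) \<and> triple_free Q (0 # xs))}"

text \<open>A continuation starts with another zero, or with a positive \<open>c \<le> i\<close>. In the second case the
  avoidance of \<open>012\<close> keeps all later entries at or below \<open>c\<close>, so the bounds on them hold by themselves
  and the count depends only on \<open>c\<close> and the length.\<close>

lemma card_good_continuations_Suc:
  assumes Q0: "\<And>a b. \<not> Q 0 a b"
  shows "card (good_continuations Q i (Suc m)) =
    card (good_continuations Q (Suc i) m) + (\<Sum>c=1..i. card (good_tails Q c m))"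
proof -
  let ?F = "\<lambda>h. {ys. length ys = m \<and> ((\<forall>j<Suc m. (h # ys) ! j \<le> i + j) \<and>
     triple_free (\<lambda>x y z. x < y \<and> y < z) (0 # h # ys) \<and> triple_free Q (0 # h # ys))}"
  have "card (good_continuations Q i (Suc m)) = (\<Sum>h\<le>i + m. card (?F h))"
    unfolding good_continuations_def
    by (rule card_lists_by_head) (fastforce simp: in_set_conv_nth)+
  also have "\<dots> = (\<Sum>h\<le>i. card (?F h))"
  proof (rule sum.mono_neutral_right)
    show "\<forall>h\<in>{..i + m} - {..i}. card (?F h) = 0"
    proof
      fix h assume "h \<in> {..i + m} - {..i}"
      then have "?F h = {}" by (auto simp: All_less_Suc2)
      then show "card (?F h) = 0" by (simp only: card.empty)
    qed
  qed auto
  also have "\<dots> = card (?F 0) + (\<Sum>h=1..i. card (?F h))"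
    by (simp only: atMost_atLeast0 sum.atLeast_Suc_atMost[of 0 i] One_nat_def)
  also have "?F 0 = good_continuations Q (Suc i) m"
  proof -
    have "sorted_wrt (\<lambda>a b. \<not> (0 < a \<and> a < b)) ys \<longleftrightarrow> sorted_wrt (\<lambda>a b. \<not> (0 < a \<and> a < b)) (0 # ys)" for ys :: "nat list"
      by simp
    then show ?thesis
      by (simp add: good_continuations_def All_less_Suc2 Q0 conj_ac cong: conj_cong)
  qed
  also have "(\<Sum>h=1..i. card (?F h)) = (\<Sum>c=1..i. card (good_tails Q c m))"
  proof (rule sum.cong[OF refl])
    fix c assume c: "c \<in> {1..i}"
    have "(c # ys) ! j \<le> i + j"
      if "ys \<in> good_tails Q c m" "j < Suc m" for ys j
    proof -
      have "set ys \<subseteq> {..c}" "length ys = m"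
        using that c by (auto simp: good_tails_def)
      then have "set (c # ys) \<subseteq> {..c}" by simp
      moreover have "(c # ys) ! j \<in> set (c # ys)"
        using that \<open>length ys = m\<close> by (intro nth_mem) simp
      ultimately show ?thesis using c by (auto simp del: nth_mem)
    qed
    then have "?F c = good_tails Q c m"
      unfolding good_tails_def by blast
    then show "card (?F c) = card (good_tails Q c m)" by simp
  qed
  finally show ?thesis .
qed

lemma card_good_continuations:
  assumes "\<And>a b. \<not> Q 0 a b"
  shows "card (good_continuations Q i m) =
    1 + (\<Sum>k<m. \<Sum>c=1..i + k. card (good_tails Q c (m - 1 - k)))"
proof (induction m arbitrary: i)
  case 0
  have "good_continuations Q i 0 = {[]}"
    by (auto simp: good_continuations_def)
  then show ?case by simp
next
  case (Suc m)
  show ?case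
    unfolding card_good_continuations_Suc[of Q, OF assms] Suc.IH sum.lessThan_Suc_shift by simp
qed

text \<open>A nonempty inversion sequence already begins with \<open>0\<close>, so the artificial zero in front
  creates no new occurrence.\<close>

lemma inversion_sequences_avoiding_eq_good_continuations:
  assumes "\<And>w :: nat list. avoids_pattern w P \<longleftrightarrow> triple_free Q w" and Q0: "\<And>a b. \<not> Q 0 a b"
  shows "inversion_sequences_avoiding n ([0, 1, 2], P) = good_continuations Q 0 n"
proof (cases n)
  case 0
  then show ?thesis
    by (auto simp: inversion_sequences_avoiding_def inversion_sequences_def
        good_continuations_def assms avoids_012_iff[of "[] :: nat list", simplified])
next
  case (Suc m)
  have "triple_free (\<lambda>x y z. x < y \<and> y < z) (0 # e) \<longleftrightarrow> triple_free (\<lambda>x y z. x < y \<and> y < z) e"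
       "triple_free Q (0 # e) \<longleftrightarrow> triple_free Q e"
    if e: "length e = n" "\<forall>j<n. e ! j \<le> j" for e
  proof -
    obtain ys where "e = 0 # ys"
      using e Suc by (cases e) auto
    then show "triple_free (\<lambda>x y z. x < y \<and> y < z) (0 # e) \<longleftrightarrow> triple_free (\<lambda>x y z. x < y \<and> y < z) e"
      "triple_free Q (0 # e) \<longleftrightarrow> triple_free Q e"
      by (auto simp: Q0)
  qed
  then show ?thesis
    unfolding inversion_sequences_avoiding_def inversion_sequences_def
        good_continuations_def fst_conv snd_conv assms(1) avoids_012_iff
    by auto
qed

section \<open>Tails after the first positive entry\<close>

lemma sorted_wrt_conj:
  "sorted_wrt (\<lambda>a b. R a b \<and> S a b) xs \<longleftrightarrow> sorted_wrt R xs \<and> sorted_wrt S xs"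
  by (induction xs) auto

lemma sorted_wrt_if_all:
  "(\<And>a b. a \<in> set xs \<Longrightarrow> b \<in> set xs \<Longrightarrow> R a b) \<Longrightarrow> sorted_wrt R xs"
  by (induction xs) auto

text \<open>The first letter of an occurrence may be any entry of the word, so a condition on pairs
  excludes the pattern as soon as it does so for each such entry.\<close>

lemma triple_free_if_sorted_wrt:
  assumes "sorted_wrt R w" and "\<And>x a b. x \<in> set w \<Longrightarrow> R a b \<Longrightarrow> \<not> Q x a b"
  shows "triple_free Q w"
  using assms
proof (induction w)
  case (Cons x w)
  from Cons.prems have "sorted_wrt (\<lambda>a b. \<not> Q x a b) w"
    by (auto elim: sorted_wrt_mono_rel[rotated])
  with Cons show ?case by auto
qed simp

text \<open>Monotonicity of \<open>Q\<close> in its first argument says that an occurrence within the tail remains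
  one when its first letter is replaced by \<open>c\<close>. Among the \<open>012\<close>-conditions, the one for
  the leading \<open>0\<close> is the strongest; applied to the letter \<open>c\<close> it also bounds the tail by \<open>c\<close>.\<close>

lemma good_tails_eq:
  assumes "c > 0" and Q0: "\<And>a b. \<not> Q 0 a b"
    and mono: "\<And>x a b. Q x a b \<Longrightarrow> x \<le> c \<Longrightarrow> Q c a b"
  shows "good_tails Q c m = {xs. length xs = m \<and>
    (set xs \<subseteq> {..c} \<and> sorted_wrt (\<lambda>a b. (0 < a \<longrightarrow> b \<le> a) \<and> \<not> Q c a b) xs)}"
proof -
  have "triple_free (\<lambda>x y z. x < y \<and> y < z) (0 # c # xs) \<and> triple_free Q (0 # c # xs)
    \<longleftrightarrow> set xs \<subseteq> {..c} \<and> sorted_wrt (\<lambda>a b. (0 < a \<longrightarrow> b \<le> a) \<and> \<not> Q c a b) xs" (is "?L \<longleftrightarrow> ?R") for xs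
  proof
    assume ?L
    then show ?R using \<open>c > 0\<close>
      by (auto simp: sorted_wrt_conj not_less imp_conv_disj)
  next
    assume R: ?R
    then have "triple_free (\<lambda>x y z. x < y \<and> y < z) xs" "triple_free Q xs"
      by (auto elim!: triple_free_if_sorted_wrt dest: mono)
    moreover have "sorted_wrt (\<lambda>a b. x < a \<longrightarrow> \<not> a < b) xs" for x
      using R by (auto elim: sorted_wrt_mono_rel[rotated])
    moreover have "sorted_wrt (\<lambda>a b. \<not> Q c a b) xs"
      using R by (auto elim: sorted_wrt_mono_rel[rotated])
    moreover have "sorted_wrt (\<lambda>a b. True) xs"
      by (simp add: sorted_wrt_iff_nth_less)
    ultimately show ?L
      using R by (auto simp: Q0 not_less imp_conv_disj sorted_wrt_conj)
  qed
  then show ?thesis by (simp add: good_tails_def)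
qed

section \<open>Counting the tails\<close>

lemma Suc_sum_choose_from_1: "Suc (\<Sum>h=1..a. (h + m) choose m) = Suc (a + m) choose Suc m"
  by (induction a) auto

lemma card_weakly_decreasing_lists:
  "card {xs :: nat list. length xs = m \<and> (set xs \<subseteq> {..a} \<and> sorted_wrt (\<ge>) xs)} = (a + m) choose m"
proof (induction m arbitrary: a)
  case 0
  have "{xs. length xs = 0 \<and> (set xs \<subseteq> {..a} \<and> sorted_wrt (\<ge>) xs)} = {[]}" by auto
  then show ?case by simp
next
  case (Suc m)
  have "card {xs. length xs = Suc m \<and> (set xs \<subseteq> {..a} \<and> sorted_wrt (\<ge>) xs)} =
    (\<Sum>h\<le>a. card {ys. length ys = m \<and> (set (h # ys) \<subseteq> {..a} \<and> sorted_wrt (\<ge>) (h # ys))})"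
    by (rule card_lists_by_head) auto
  also have "\<dots> = (\<Sum>h\<le>a. (h + m) choose m)"
  proof (rule sum.cong[OF refl])
    fix h assume "h \<in> {..a}"
    then have "{ys. length ys = m \<and> (set (h # ys) \<subseteq> {..a} \<and> sorted_wrt (\<ge>) (h # ys))}
      = {ys. length ys = m \<and> (set ys \<subseteq> {..h} \<and> sorted_wrt (\<ge>) ys)}"
      by auto
    then show "card {ys. length ys = m \<and> (set (h # ys) \<subseteq> {..a} \<and> sorted_wrt (\<ge>) (h # ys))}
      = (h + m) choose m" by (simp add: Suc.IH)
  qed
  also have "\<dots> = (a + Suc m) choose Suc m"
    using choose_rising_sum(1)[of m a] by (simp add: ac_simps)
  finally show ?case .
qed

lemma sum_atMost_split_ends:
  fixes f :: "nat \<Rightarrow> nat"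
  assumes "c > 0"
  shows "(\<Sum>h\<le>c. f h) = f 0 + f c + (\<Sum>h=1..<c. f h)"
proof -
  have "{..c} = insert 0 (insert c {1..<c})"
    using assms by auto
  then show ?thesis using assms by simp
qed

text \<open>Splitting by the first letter \<open>h\<close> gives
  \<open>t(c, m + 1) = 2^m + t(c, m) + (\<Sum>h=1..<c. binom(h + m, m))\<close>, for \<open>h = 0\<close>, \<open>h = c\<close> and \<open>0 < h < c\<close>
  respectively; the last sum is \<open>binom(c + m, m + 1) - 1\<close>.\<close>

lemma card_good_tails_201:
  assumes "c > 0"
  shows "int (card (good_tails (\<lambda>x y z. y < z \<and> z < x) c m)) =
    2 ^ m + int ((c + m) choose m) - int (Suc m)"
proof -
  let ?P = "\<lambda>xs. set xs \<subseteq> {..c} \<and> sorted_wrt (\<lambda>a b. (0 < a \<longrightarrow> b \<le> a) \<and> \<not> (a < b \<and> b < c)) xs"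
  have eq: "good_tails (\<lambda>x y z. y < z \<and> z < x) c m = {xs. length xs = m \<and> ?P xs}" for m
    using assms by (intro good_tails_eq) auto
  show ?thesis
  proof (induction m)
    case 0
    have "{xs. length xs = 0 \<and> ?P xs} = {[]}" by auto
    then show ?case by (simp add: eq)
  next
    case (Suc m)
    let ?F = "\<lambda>h. {ys. length ys = m \<and> ?P (h # ys)}"
    have zero: "?F 0 = {ys. set ys \<subseteq> {0, c} \<and> length ys = m}"
    proof -
      have "?P (0 # ys) \<longleftrightarrow> set ys \<subseteq> {0, c}" for ys
      proof
        show "set ys \<subseteq> {0, c}" if "?P (0 # ys)"
          using that by fastforce
        show "?P (0 # ys)" if "set ys \<subseteq> {0, c}"
        proof -
          have "(0 < a \<longrightarrow> b \<le> a) \<and> \<not> (a < b \<and> b < c)" if "a \<in> {0, c}" "b \<in> {0, c}" for a b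
            using that by auto
          with that have "sorted_wrt (\<lambda>a b. (0 < a \<longrightarrow> b \<le> a) \<and> \<not> (a < b \<and> b < c)) ys"
            by (intro sorted_wrt_if_all) blast
          with that show ?thesis by fastforce
        qed
      qed
      then show ?thesis by blast
    qed
    \<comment> \<open>After \<open>h\<close> the letter \<open>c\<close> is too large to recur, and it is the only one that may
      exceed an earlier letter of the tail.\<close>
    have mid: "?F h = {ys. length ys = m \<and> (set ys \<subseteq> {..h} \<and> sorted_wrt (\<ge>) ys)}"
      if h: "h \<in> {1..<c}" for h
    proof -
      have "?P (h # ys) \<longleftrightarrow> set ys \<subseteq> {..h} \<and> sorted_wrt (\<ge>) ys" for ys
      proof
        assume P: "?P (h # ys)"
        then have le: "set ys \<subseteq> {..h}" using h by auto
        have "sorted_wrt (\<lambda>a b. (0 < a \<longrightarrow> b \<le> a) \<and> \<not> (a < b \<and> b < c)) ys"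
          using P by simp
        then have "sorted_wrt (\<ge>) ys"
          by (rule sorted_wrt_mono_rel[rotated]) (use le h in force)
        with le show "set ys \<subseteq> {..h} \<and> sorted_wrt (\<ge>) ys" ..
      next
        assume "set ys \<subseteq> {..h} \<and> sorted_wrt (\<ge>) ys"
        then show "?P (h # ys)"
          using h by (fastforce elim: sorted_wrt_mono_rel[rotated])
      qed
      then show ?thesis by blast
    qed
    have last: "?F c = {ys. length ys = m \<and> ?P ys}"
      using assms by auto
    have "card {xs. length xs = Suc m \<and> ?P xs} = (\<Sum>h\<le>c. card (?F h))"
      by (rule card_lists_by_head) auto
    also have "\<dots> = card (?F 0) + card (?F c) + (\<Sum>h=1..<c. card (?F h))"
      by (rule sum_atMost_split_ends[OF assms])
    finally have "card {xs. length xs = Suc m \<and> ?P xs} =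
      card (?F 0) + card (?F c) + (\<Sum>h=1..<c. card (?F h))" .
    moreover have "(\<Sum>h=1..<c. card (?F h)) = (\<Sum>h=1..<c. (h + m) choose m)"
      by (rule sum.cong[OF refl]) (simp only: mid card_weakly_decreasing_lists)
    moreover have "Suc (\<Sum>h=1..<c. (h + m) choose m) = (c + m) choose Suc m"
      using Suc_sum_choose_from_1[where a = "c - 1" and m = m] assms
      by (cases c) (simp_all only: atLeastLessThanSuc_atLeastAtMost add_Suc diff_Suc_1 less_irrefl)
    moreover have "card (?F 0) = 2 ^ m"
      using assms by (simp only: zero) (simp add: card_lists_length_eq numeral_2_eq_2)
    moreover have "?F c = good_tails (\<lambda>x y z. y < z \<and> z < x) c m"
      by (simp only: last eq)
    ultimately have "Suc (card (good_tails (\<lambda>x y z. y < z \<and> z < x) c (Suc m))) =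
      2 ^ m + card (good_tails (\<lambda>x y z. y < z \<and> z < x) c m) + ((c + m) choose Suc m)"
      by (simp only: eq flip: add_Suc_right)
    from arg_cong[OF this, of int]
    have "int (card (good_tails (\<lambda>x y z. y < z \<and> z < x) c (Suc m))) =
      2 ^ m + int (card (good_tails (\<lambda>x y z. y < z \<and> z < x) c m)) + int ((c + m) choose Suc m) - 1"
      by simp
    then show ?case
      using Suc.IH by simp
  qed
qed

text \<open>The letters \<open>0\<close> and \<open>c\<close> leave the condition on the rest unchanged and any other letter leaves
  one completion, so \<open>t(c, m + 1) = 2 t(c, m) + (c - 1)\<close>.\<close>

lemma card_good_tails_210:
  assumes "c > 0"
  shows "int (card (good_tails (\<lambda>x y z. z < y \<and> y < x) c m)) =
    2 ^ m + (int c - 1) * (2 ^ m - 1)"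
proof -
  let ?P = "\<lambda>xs. set xs \<subseteq> {..c} \<and> sorted_wrt (\<lambda>a b. (0 < a \<longrightarrow> b \<le> a) \<and> \<not> (b < a \<and> a < c)) xs"
  have eq: "good_tails (\<lambda>x y z. z < y \<and> y < x) c m = {xs. length xs = m \<and> ?P xs}" for m
    using assms by (intro good_tails_eq) auto
  show ?thesis
  proof (induction m)
    case 0
    have "{xs. length xs = 0 \<and> ?P xs} = {[]}" by auto
    then show ?case by (simp add: eq)
  next
    case (Suc m)
    let ?F = "\<lambda>h. {ys. length ys = m \<and> ?P (h # ys)}"
    have free: "?F h = {ys. length ys = m \<and> ?P ys}" if "h \<in> {0, c}" for h
      using that by auto
    \<comment> \<open>A smaller letter would complete \<open>210\<close> with \<open>c\<close> and \<open>h\<close>, a larger one \<open>012\<close>.\<close>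
    have mid: "?F h = {replicate m h}" if h: "h \<in> {1..<c}" for h
    proof -
      have "?P (h # ys) \<longleftrightarrow> (\<forall>b\<in>set ys. b = h)" for ys
      proof
        show "\<forall>b\<in>set ys. b = h" if "?P (h # ys)"
          using that h by fastforce
        show "?P (h # ys)" if "\<forall>b\<in>set ys. b = h"
        proof -
          have "(0 < a \<longrightarrow> b \<le> a) \<and> \<not> (b < a \<and> a < c)" if "a = h" "b = h" for a b
            using that by auto
          with that have "sorted_wrt (\<lambda>a b. (0 < a \<longrightarrow> b \<le> a) \<and> \<not> (b < a \<and> a < c)) ys"
            by (intro sorted_wrt_if_all) blast
          with that h show ?thesis by auto
        qed
      qed
      then show ?thesis by (auto intro: replicate_eqI)
    qed
    have "card {xs. length xs = Suc m \<and> ?P xs} = (\<Sum>h\<le>c. card (?F h))"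
      by (rule card_lists_by_head) auto
    also have "\<dots> = card (?F 0) + card (?F c) + (\<Sum>h=1..<c. card (?F h))"
      by (rule sum_atMost_split_ends[OF assms])
    finally have "card {xs. length xs = Suc m \<and> ?P xs} =
      card (?F 0) + card (?F c) + (\<Sum>h=1..<c. card (?F h))" .
    moreover have "(\<Sum>h=1..<c. card (?F h)) = (\<Sum>h=1..<c. card {replicate m h})"
      by (rule sum.cong[OF refl]) (simp only: mid)
    moreover have "\<dots> = c - 1" by simp
    moreover have "?F 0 = good_tails (\<lambda>x y z. z < y \<and> y < x) c m"
      by (subst free) (simp_all add: eq)
    moreover have "?F c = good_tails (\<lambda>x y z. z < y \<and> y < x) c m"
      by (subst free) (simp_all add: eq)
    ultimately have "card (good_tails (\<lambda>x y z. z < y \<and> y < x) c (Suc m)) =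
      2 * card (good_tails (\<lambda>x y z. z < y \<and> y < x) c m) + (c - 1)"
      by (simp only: eq mult_2)
    then show ?case
      using Suc.IH assms by (simp add: of_nat_diff algebra_simps)
  qed
qed

section \<open>Summation over the first positive entry and its position\<close>

lemma sum_mult_power_two: "(\<Sum>i<n. int i * 2 ^ (n - 1 - i)) = 2 ^ n - int n - 1"
proof (induction n)
  case (Suc n)
  have "(\<Sum>i<n. int i * 2 ^ (n - i)) = (\<Sum>i<n. 2 * (int i * 2 ^ (n - 1 - i)))"
    by (rule sum.cong) (simp_all add: Suc_diff_Suc flip: power_Suc)
  then show ?case
    using Suc by (simp flip: sum_distrib_left)
qed simp

lemma sum_choose_two_mult_power_two:
  "(\<Sum>i<n. int (i choose 2) * 2 ^ (n - 1 - i)) = 2 ^ n - 1 - int n - int (n choose 2)"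
proof (induction n)
  case (Suc n)
  have "(\<Sum>i<n. int (i choose 2) * 2 ^ (n - i)) = (\<Sum>i<n. 2 * (int (i choose 2) * 2 ^ (n - 1 - i)))"
    by (rule sum.cong) (simp_all add: Suc_diff_Suc flip: power_Suc)
  then show ?case
    using Suc by (simp add: numeral_2_eq_2 flip: sum_distrib_left)
qed (simp add: numeral_2_eq_2)

lemma sum_choose_two: "(\<Sum>i<n. int (i choose 2)) = int (n choose 3)"
  by (induction n) (simp_all add: numeral_eq_Suc)

lemma sum_mult_diff: "(\<Sum>i<n. int i * int (n - i)) = int (Suc n choose 3)"
proof (induction n)
  case (Suc n)
  have "(\<Sum>i<n. int i * int (Suc n - i)) = (\<Sum>i<n. int i * int (n - i)) + (\<Sum>i<n. int i)"
    unfolding sum.distrib[symmetric] by (rule sum.cong) (simp_all add: Suc_diff_le algebra_simps)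
  moreover have "(\<Sum>i<n. int i) + int n = int (Suc n choose 2)"
    by (induction n) (simp_all add: numeral_eq_Suc)
  ultimately show ?case
    using Suc by (simp add: numeral_eq_Suc)
qed (simp add: numeral_eq_Suc)

lemma sum_int_pred: "(\<Sum>c=1..i. int c - 1) = int (i choose 2)"
  by (induction i) (simp_all add: numeral_eq_Suc)

lemma sum_card_good_tails_201:
  "(\<Sum>c=1..i. int (card (good_tails (\<lambda>x y z. y < z \<and> z < x) c m))) =
    int i * 2 ^ m - int i * int (Suc m) + int (Suc (i + m) choose Suc m) - 1"
proof -
  have "(\<Sum>c=1..i. int (card (good_tails (\<lambda>x y z. y < z \<and> z < x) c m))) =
    (\<Sum>c=1..i. (2 ^ m - int (Suc m)) + int ((c + m) choose m))"
    by (rule sum.cong) (simp_all add: card_good_tails_201)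
  also have "\<dots> = int i * (2 ^ m - int (Suc m)) + (\<Sum>c=1..i. int ((c + m) choose m))"
    by (simp only: sum.distrib) simp
  also have "(\<Sum>c=1..i. int ((c + m) choose m)) = int (Suc (i + m) choose Suc m) - 1"
    using arg_cong[OF Suc_sum_choose_from_1[where a = i and m = m], of int] by simp
  finally show ?thesis
    by (simp add: algebra_simps)
qed

lemma sum_card_good_tails_210:
  "(\<Sum>c=1..i. int (card (good_tails (\<lambda>x y z. z < y \<and> y < x) c m))) =
    int i * 2 ^ m + int (i choose 2) * (2 ^ m - 1)"
proof -
  have "(\<Sum>c=1..i. int (card (good_tails (\<lambda>x y z. z < y \<and> y < x) c m))) =
    (\<Sum>c=1..i. 2 ^ m + (int c - 1) * (2 ^ m - 1))"
    by (rule sum.cong) (simp_all add: card_good_tails_210)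
  also have "\<dots> = int i * 2 ^ m + (\<Sum>c=1..i. int c - 1) * (2 ^ m - 1)"
    by (simp only: sum.distrib sum_distrib_right) simp
  finally show ?thesis by (simp only: sum_int_pred)
qed

theorem theorem2p15:
  fixes n :: nat and p :: "nat list \<times> nat list"
  assumes "n \<ge> 1"
    and "p \<in> {([0,1,2], [2,0,1]), ([0,1,2], [2,1,0])}"
  shows "int (card (inversion_sequences_avoiding n p))
           = 2 ^ (n + 1) - int ((n + 1) choose 3) - 2 * int n - 1"
  using assms(2)
proof (elim insertE emptyE)
  let ?Q = "\<lambda>x y z :: nat. y < z \<and> z < x"
  assume p: "p = ([0,1,2], [2,0,1])"
  have "inversion_sequences_avoiding n p = good_continuations ?Q 0 n"
    unfolding p by (rule inversion_sequences_avoiding_eq_good_continuations[OF avoids_201_iff]) simp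
  then have "int (card (inversion_sequences_avoiding n p)) =
    1 + (\<Sum>i<n. \<Sum>c=1..i. int (card (good_tails ?Q c (n - 1 - i))))"
    by (simp add: card_good_continuations)
  also have "\<dots> = 1 + (\<Sum>i<n. int i * 2 ^ (n - 1 - i) - int i * int (n - i) + int (n choose i) - 1)"
  proof -
    \<comment> \<open>Here the tail has length \<open>m = n - 1 - i\<close>, so \<open>binom(i + m + 1, m + 1)\<close> lies in row \<open>n\<close> for
      every \<open>i\<close>, and the sum over \<open>i\<close> runs through that row except for its last entry.\<close>
    have "Suc (i + (n - 1 - i)) = n \<and> Suc (n - 1 - i) = n - i \<and> (n choose (n - i)) = (n choose i)"
      if "i < n" for i
      using that binomial_symmetric[of i n] by auto
    then show ?thesis
      by (intro arg_cong2[where f = "(+)"] refl sum.cong)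
        (simp only: sum_card_good_tails_201 lessThan_iff)
  qed
  also have "\<dots> = 1 + (2 ^ n - int n - 1) - int (Suc n choose 3) + (\<Sum>i<n. int (n choose i)) - int n"
    by (simp only: sum.distrib sum_subtractf sum_mult_power_two sum_mult_diff) simp
  also have "(\<Sum>i<n. int (n choose i)) = 2 ^ n - 1"
    using arg_cong[OF choose_row_sum[of n], of int]
    by (simp add: lessThan_Suc_atMost[symmetric])
  finally show ?thesis by simp
next
  let ?Q = "\<lambda>x y z :: nat. z < y \<and> y < x"
  assume p: "p = ([0,1,2], [2,1,0])"
  have "inversion_sequences_avoiding n p = good_continuations ?Q 0 n"
    unfolding p by (rule inversion_sequences_avoiding_eq_good_continuations[OF avoids_210_iff]) simp
  then have "int (card (inversion_sequences_avoiding n p)) =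
    1 + (\<Sum>i<n. \<Sum>c=1..i. int (card (good_tails ?Q c (n - 1 - i))))"
    by (simp add: card_good_continuations)
  also have "\<dots> = 1 + (\<Sum>i<n. int i * 2 ^ (n - 1 - i)
      + int (i choose 2) * 2 ^ (n - 1 - i) - int (i choose 2))"
    by (simp only: sum_card_good_tails_210) (simp add: algebra_simps)
  also have "\<dots> = 1 + (2 ^ n - int n - 1) + (2 ^ n - 1 - int n - int (n choose 2)) - int (n choose 3)"
    by (simp only: sum.distrib sum_subtractf sum_mult_power_two sum_choose_two_mult_power_two
        sum_choose_two)
  finally show ?thesis by (simp add: numeral_eq_Suc)
qed

end
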